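(* The equation $$\mu\circ\theta=\tau_{\xi}\left(\mu+\delta_{\sigma}\right),\qquad \mathbf P^0\text{-a.s.},\qquad (\ast)$$ in the unknown $\mathcal M$-valued random variable $\mu$, admits a ($\mathbf P^0$-a.s. finite) solution, given by $$\mu^{PD}=\sum_{i=1}^{\infty}\delta_{\left(\sigma_{-i}-\sum_{j=1}^{i}\xi_{-j}\right)}\mathbf 1_{\left\{\sigma_{-i}>\sum_{j=1}^{i}\xi_{-j}\right\}}.$$ Moreover, let $$L:=\left[\sup_{j\ge 1}\left(\sigma_{-j}-\sum_{i=1}^{j}\xi_{-i}\right)\right]^+ .$$ If $\mathbf P^0[L\le 0]>0$, then this solution is unique (up to $\mathbf P^0$-a.s. equality, among $\mathcal M$-valued random variables), and for every $\mathcal M$-valued random variable $\zeta$ such that $Z(\zeta)\le L$, $\mathbf P^0$-a.s., the sequence $\{\mu_n^{[\zeta]}\}_{n\in\mathbb N}$ defined by $\mu_0^{[\zeta]}=\zeta$ and $\mu_{n+1}^{[\zeta]}=\tau_{\xi_n}(\mu_n^{[\zeta]}+\delta_{\sigma_n})$, $n\in\mathbb N$, converges with strong backwards coupling to $\mu^{PD}$.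
   Context: Probabilistic setting. $(\Omega,\mathcal F,\mathbf P)$ is a probability space with a bijective measurable flow $(\theta_t)$ under which $\mathbf P$ is stationary and ergodic; on it is defined a $\theta_t$-compatible simple point process $A$ with points $\dots<T_{-1}<T_0\le 0<T_1<\dots$ (arrival times of customers $C_n$), marked by the sequence $\{\sigma_n\}_{n\in\mathbb Z}$ of positive service durations; $\xi_n=T_{n+1}-T_n>0$. $\mathbf P^0$ is the Palm probability of $A$, $\theta:=\theta_{T_1}$, $\xi:=\xi_0$, $\sigma:=\sigma_0$. Thus on $(\Omega,\mathcal F,\mathbf P^0)$, $\theta$ is a bijective bi-measurable map, $\mathbf P^0$ is $\theta$-stationary ($\mathbf P^0[\theta^{-1}\mathfrak A]=\mathbf P^0[\mathfrak A]$ for all $\mathfrak A\in\mathcal F$) and $\theta$-ergodic ($\theta\mathfrak A=\mathfrak A$ implies $\mathbf P^0[\mathfrak A]\in\{0,1\}$), and $\xi_n=\xi\circ\theta^n$, $\sigma_n=\sigma\circ\theta^n$ for all $n\in\mathbb Z$. The random variables $\xi$ and $\sigma$ are positive and integrable. Measures. $\mathcal M$ is the set of finite counting measures on $(0,\infty)$ (finite sums of Dirac masses, atoms counted with multiplicity, including the zero measure $\mathbf 0$), with the Borel $\sigma$-algebra of the weak topology. A nonzero $\mu\in\mathcal M$ is written $\mu=\sum_{i=1}^{N(\mu)}\delta_{\alpha_i(\mu)}$ with $\alpha_1(\mu)\le\dots\le\alpha_{N(\mu)}(\mu)$, $N(\mu)=\mu((0,\infty))$. $Z(\mu):=\alpha_{N(\mu)}(\mu)$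 is the largest atom, with $Z(\mathbf 0):=0$. For $y\ge 0$, $\tau_y\mu=\sum_{i=1}^{N(\mu)}\delta_{\alpha_i(\mu)-y}\mathbf 1_{\{\alpha_i(\mu)>y\}}$. Also $x^+=\max(x,0)$. Strong backwards coupling. A sequence of random variables $\{X_n\}_{n\in\mathbb N}$ converges with strong backwards coupling to $Y$ if $\mathbf P^0$-a.s. there is a finite (random) $N'$ such that $X_n\circ\theta^{-n}=Y$ for all $n\ge N'$. Interpretation: this is the G/G/$\infty$ queue; $\mu_n$ is the point measure of remaining service times of customers just before the $n$-th arrival. *)

theory Defs
  imports "HOL-Probability.Probability"
begin

definition pos_borel :: "real measure" where
  "pos_borel = restrict_space borel {0<..}"

definition dirac_sum :: "real list \<Rightarrow> real measure" where
  "dirac_sum xs = measure_of (space pos_borel) (sets pos_borel) (\<lambda>B. \<Sum>x\<leftarrow>xs. indicator B x)"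

definition counting_measures :: "real measure set" where
  "counting_measures = dirac_sum ` {xs. set xs \<subseteq> {0<..}}"

text \<open>The weak topology is the coarsest one making every map \<open>\<mu> \<mapsto> \<integral>f d\<mu>\<close> continuous, for
  \<open>f\<close> bounded and continuous on the positive half-line. All of \<^const>\<open>counting_measures\<close> is
  among the generating sets (take \<open>U = UNIV\<close>), so it is the underlying space of the topology.\<close>

definition weak_topology :: "real measure topology" where
  "weak_topology = topology_generated_by
     {{\<mu> \<in> counting_measures. integral\<^sup>L \<mu> f \<in> U} | f U.
        continuous_on {0<..} f \<and> bounded (f ` {0<..}) \<and> open (U :: real set)}"

definition counting_algebra :: "real measure measure" where
  "counting_algebra = sigma counting_measures {W. openin weak_topology W}"

text \<open>The nondecreasing list \<open>\<alpha>\<^sub>1(\<mu>), \<dots>, \<alpha>\<^sub>N(\<mu>)\<close> of the atoms of \<open>\<mu>\<close>, repeated according to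
  multiplicity. Meaningful only for \<open>\<mu>\<close> in \<^const>\<open>counting_measures\<close>.\<close>

definition atoms :: "real measure \<Rightarrow> real list" where
  "atoms \<mu> = (THE xs. sorted xs \<and> set xs \<subseteq> {0<..} \<and> \<mu> = dirac_sum xs)"

definition largest_atom :: "real measure \<Rightarrow> real" where
  "largest_atom \<mu> = (if atoms \<mu> = [] then 0 else last (atoms \<mu>))"

definition shift_down :: "real \<Rightarrow> real measure \<Rightarrow> real measure" where
  "shift_down y \<mu> = dirac_sum (map (\<lambda>a. a - y) (filter (\<lambda>a. a > y) (atoms \<mu>)))"

definition add_dirac :: "real measure \<Rightarrow> real \<Rightarrow> real measure" where
  "add_dirac \<mu> x = measure_of (space pos_borel) (sets pos_borel)
     (\<lambda>B. emeasure \<mu> B + emeasure (return pos_borel x) B)"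

text \<open>Here \<open>P\<close> plays the role of the Palm probability and \<open>\<theta>\<close> that of the shift to the next
  point of the arrival process.\<close>

locale ergodic_shift = prob_space P for P :: "'a measure" +
  fixes \<theta> :: "'a \<Rightarrow> 'a"
  assumes bij_shift: "bij_betw \<theta> (space P) (space P)"
    and measurable_shift: "\<theta> \<in> P \<rightarrow>\<^sub>M P"
    and measurable_inv_shift: "inv_into (space P) \<theta> \<in> P \<rightarrow>\<^sub>M P"
    and stationary: "A \<in> sets P \<Longrightarrow> measure P (\<theta> -` A \<inter> space P) = measure P A"
    and ergodic: "A \<in> sets P \<Longrightarrow> \<theta> ` A = A \<Longrightarrow> measure P A = 0 \<or> measure P A = 1"

definition shift_pow :: "'a measure \<Rightarrow> ('a \<Rightarrow> 'a) \<Rightarrow> int \<Rightarrow> 'a \<Rightarrow> 'a" where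
  "shift_pow P \<theta> k = (if 0 \<le> k then \<theta> ^^ nat k else inv_into (space P) \<theta> ^^ nat (- k))"

definition strong_backwards_coupling ::
  "'a measure \<Rightarrow> ('a \<Rightarrow> 'a) \<Rightarrow> (nat \<Rightarrow> 'a \<Rightarrow> 'b) \<Rightarrow> ('a \<Rightarrow> 'b) \<Rightarrow> bool" where
  "strong_backwards_coupling P \<theta> X Y \<longleftrightarrow>
     (AE \<omega> in P. \<exists>N. \<forall>n\<ge>N. X n (shift_pow P \<theta> (- int n) \<omega>) = Y \<omega>)"

text \<open>\<open>\<sigma>\<^bsub>-j\<^esub> - (\<xi>\<^bsub>-1\<^esub> + \<dots> + \<xi>\<^bsub>-j\<^esub>)\<close>, the remaining service time at time 0 (if positive) of the
  customer that arrived \<open>j\<close> places before customer 0.\<close>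

definition residual ::
  "'a measure \<Rightarrow> ('a \<Rightarrow> 'a) \<Rightarrow> ('a \<Rightarrow> real) \<Rightarrow> ('a \<Rightarrow> real) \<Rightarrow> nat \<Rightarrow> 'a \<Rightarrow> real" where
  "residual P \<theta> \<xi> \<sigma> j \<omega> = \<sigma> (shift_pow P \<theta> (- int j) \<omega>)
     - (\<Sum>i = 1..j. \<xi> (shift_pow P \<theta> (- int i) \<omega>))"

text \<open>The sum ranges over \<open>j = Suc i \<ge> 1\<close>. It may have infinitely many nonzero terms, in which
  case the measure is not in \<^const>\<open>counting_measures\<close>.\<close>

definition mu_PD ::
  "'a measure \<Rightarrow> ('a \<Rightarrow> 'a) \<Rightarrow> ('a \<Rightarrow> real) \<Rightarrow> ('a \<Rightarrow> real) \<Rightarrow> 'a \<Rightarrow> real measure" where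
  "mu_PD P \<theta> \<xi> \<sigma> \<omega> = measure_of (space pos_borel) (sets pos_borel)
     (\<lambda>B. \<Sum>i. if residual P \<theta> \<xi> \<sigma> (Suc i) \<omega> > 0
               then indicator B (residual P \<theta> \<xi> \<sigma> (Suc i) \<omega>) else 0)"

text \<open>Extended-real valued, since the supremum is only almost surely finite.\<close>

definition max_residual ::
  "'a measure \<Rightarrow> ('a \<Rightarrow> 'a) \<Rightarrow> ('a \<Rightarrow> real) \<Rightarrow> ('a \<Rightarrow> real) \<Rightarrow> 'a \<Rightarrow> ereal" where
  "max_residual P \<theta> \<xi> \<sigma> \<omega> = max (SUP j\<in>{1..}. ereal (residual P \<theta> \<xi> \<sigma> j \<omega>)) 0"

definition stationary_solution ::
  "'a measure \<Rightarrow> ('a \<Rightarrow> 'a) \<Rightarrow> ('a \<Rightarrow> real) \<Rightarrow> ('a \<Rightarrow> real) \<Rightarrow> ('a \<Rightarrow> real measure) \<Rightarrow> bool" where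
  "stationary_solution P \<theta> \<xi> \<sigma> \<mu> \<longleftrightarrow> \<mu> \<in> P \<rightarrow>\<^sub>M counting_algebra \<and>
     (AE \<omega> in P. \<mu> (\<theta> \<omega>) = shift_down (\<xi> \<omega>) (add_dirac (\<mu> \<omega>) (\<sigma> \<omega>)))"

primrec queue_seq ::
  "'a measure \<Rightarrow> ('a \<Rightarrow> 'a) \<Rightarrow> ('a \<Rightarrow> real) \<Rightarrow> ('a \<Rightarrow> real) \<Rightarrow> ('a \<Rightarrow> real measure)
     \<Rightarrow> nat \<Rightarrow> 'a \<Rightarrow> real measure" where
  "queue_seq P \<theta> \<xi> \<sigma> \<zeta> 0 \<omega> = \<zeta> \<omega>"
| "queue_seq P \<theta> \<xi> \<sigma> \<zeta> (Suc n) \<omega> =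
     shift_down (\<xi> (shift_pow P \<theta> (int n) \<omega>))
       (add_dirac (queue_seq P \<theta> \<xi> \<sigma> \<zeta> n \<omega>) (\<sigma> (shift_pow P \<theta> (int n) \<omega>)))"

end

theory Submission
  imports Defs
begin

text \<open>Write \<open>S\<^sub>n = \<xi>\<^bsub>-1\<^esub> + \<dots> + \<xi>\<^bsub>-n\<^esub>\<close>. By Garsia's maximal argument and ergodicity, \<open>S\<^sub>n\<close> grows at least
  linearly, while \<open>\<sigma>\<^bsub>-n\<^esub>\<close> is eventually below any linear function by Borel--Cantelli; so almost surely
  only finitely many residuals are positive. Starting the recursion at customer \<open>-n\<close> in state \<open>\<nu>\<close>
  yields at time \<open>0\<close> the first \<open>n\<close> terms of \<open>\<mu>\<^sup>P\<^sup>D\<close> plus the shift of \<open>\<nu>\<close> by \<open>S\<^sub>n\<close>, which vanishes as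
  soon as \<open>Z(\<nu>) \<le> S\<^sub>n\<close>. For \<open>\<nu> = \<zeta> \<circ> \<theta>\<^sup>-\<^sup>n\<close> with \<open>Z(\<zeta>) \<le> L\<close> this holds for all large \<open>n\<close>, because
  \<open>L \<circ> \<theta>\<^sup>-\<^sup>n - S\<^sub>n\<close> is at most the larger of \<open>-S\<^sub>n\<close> and the supremum of the residuals beyond \<open>n\<close>. For
  \<open>\<nu> = \<mu> \<circ> \<theta>\<^sup>-\<^sup>n\<close> with \<open>\<mu>\<close> a stationary solution it holds for infinitely many \<open>n\<close>, because \<open>Z(\<mu> \<circ> \<theta>\<^sup>-\<^sup>n)\<close> is tight.\<close>

subsection \<open>Finite sums of Dirac masses\<close>

lemma space_pos_borel: "space pos_borel = {0<..}"
  by (simp add: pos_borel_def space_restrict_space)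

lemma sets_pos_borelD: "B \<in> sets pos_borel \<Longrightarrow> B \<subseteq> {0<..}"
  using sets.sets_into_space space_pos_borel by metis

lemma singleton_in_pos_borel: "x > 0 \<Longrightarrow> {x} \<in> sets pos_borel"
  by (auto simp: pos_borel_def sets_restrict_space image_iff intro!: bexI[of _ "{x}"])

text \<open>Realises \<open>dirac_sum\<close> as an image of counting measure, so that countable
  additivity comes for free. Indices of nonpositive entries are left out because the image map must
  land in the positive half-line.\<close>

lemma emeasure_distr_nth:
  assumes "B \<in> sets pos_borel"
  shows "emeasure (distr (count_space {i. i < length xs \<and> xs ! i > 0}) pos_borel (\<lambda>i. xs ! i)) B =
    (\<Sum>x\<leftarrow>xs. indicator B x)"
proof -
  let ?I = "{i. i < length xs \<and> xs ! i > 0}"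
  have eq: "(\<lambda>i. xs ! i) -` B \<inter> ?I = {i \<in> {0..<length xs}. xs ! i \<in> B}"
    using sets_pos_borelD[OF assms] by auto
  have "emeasure (distr (count_space ?I) pos_borel (\<lambda>i. xs ! i)) B =
      emeasure (count_space ?I) ((\<lambda>i. xs ! i) -` B \<inter> ?I)"
    using assms by (subst emeasure_distr) (auto simp: space_pos_borel)
  also have "\<dots> = of_nat (card ((\<lambda>i. xs ! i) -` B \<inter> ?I))"
    by (subst emeasure_count_space_finite) auto
  also have "\<dots> = (\<Sum>i\<in>{0..<length xs}. indicator B (xs ! i))"
    unfolding eq by (simp add: indicator_def sum.If_cases Int_def)
  finally show ?thesis by (simp add: sum_list_sum_nth)
qed

lemma dirac_sum_eq_distr:
  "dirac_sum xs = distr (count_space {i. i < length xs \<and> xs ! i > 0}) pos_borel (\<lambda>i. xs ! i)"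
    (is "_ = ?D")
proof -
  have "dirac_sum xs = measure_of (space pos_borel) (sets pos_borel) (emeasure ?D)"
    unfolding dirac_sum_def
    by (intro measure_of_eq) (auto simp: sets.space_closed sets.sigma_sets_eq emeasure_distr_nth)
  also have "\<dots> = ?D"
    using measure_of_of_measure[of ?D] by simp
  finally show ?thesis .
qed

lemma sets_dirac_sum [simp]: "sets (dirac_sum xs) = sets pos_borel"
  by (simp add: dirac_sum_eq_distr)

lemma emeasure_dirac_sum:
  "B \<in> sets pos_borel \<Longrightarrow> emeasure (dirac_sum xs) B = (\<Sum>x\<leftarrow>xs. indicator B x)"
  by (simp add: dirac_sum_eq_distr emeasure_distr_nth)

lemma dirac_sum_cong:
  assumes "\<And>B. B \<in> sets pos_borel \<Longrightarrow>
    (\<Sum>x\<leftarrow>xs. indicator B x :: ennreal) = (\<Sum>x\<leftarrow>ys. indicator B x)"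
  shows "dirac_sum xs = dirac_sum ys"
  by (rule measure_eqI) (simp_all add: assms emeasure_dirac_sum)

lemma dirac_sum_cong_mset: "mset xs = mset ys \<Longrightarrow> dirac_sum xs = dirac_sum ys"
  unfolding dirac_sum_def by (metis mset_map sum_mset_sum_list)

text \<open>Sets of \<open>pos_borel\<close> contain no nonpositive points, so such entries carry no
  mass. Customers who have left may therefore stay in the list.\<close>

lemma dirac_sum_filter_pos: "dirac_sum (filter (\<lambda>x. x > 0) xs) = dirac_sum xs"
proof (rule dirac_sum_cong)
  fix B assume "B \<in> sets pos_borel"
  then have "indicator B x = (0::ennreal)" if "\<not> x > 0" for x
    using sets_pos_borelD that by (fastforce simp: indicator_def)
  then show "(\<Sum>x\<leftarrow>filter (\<lambda>x. x > 0) xs. indicator B x) = (\<Sum>x\<leftarrow>xs. indicator B x :: ennreal)"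
    by (induction xs) auto
qed

lemma dirac_sum_cong_pos:
  "filter (\<lambda>x. x > 0) xs = filter (\<lambda>x. x > 0) ys \<Longrightarrow> dirac_sum xs = dirac_sum ys"
  using dirac_sum_filter_pos by metis

lemma counting_measures_eq_range: "counting_measures = range dirac_sum"
proof -
  have "dirac_sum xs \<in> counting_measures" for xs
    unfolding counting_measures_def
    by (subst dirac_sum_filter_pos[symmetric]) (auto intro!: imageI)
  then show ?thesis by (auto simp: counting_measures_def)
qed

section \<open>Atoms of a counting measure\<close>

lemma mset_eq_of_dirac_sum_eq:
  assumes "dirac_sum xs = dirac_sum ys" "set xs \<subseteq> {0<..}" "set ys \<subseteq> {0<..}"
  shows "mset xs = mset ys"
proof (rule multiset_eqI)
  \<comment> \<open>The multiplicity of \<open>x\<close> is the mass of the Borel set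
    \<open>{x}\<close>.\<close>
  have count: "(\<Sum>z\<leftarrow>zs. indicator {x} z :: ennreal) = of_nat (count (mset zs) x)" for zs and x :: real
    by (induction zs) (auto simp: add.commute)
  fix x
  show "count (mset xs) x = count (mset ys) x"
  proof (cases "x > 0")
    case True
    then show ?thesis
      using assms(1) emeasure_dirac_sum[OF singleton_in_pos_borel[OF True], of xs]
        emeasure_dirac_sum[OF singleton_in_pos_borel[OF True], of ys] count by simp
  next
    case False
    then show ?thesis using assms(2,3)
      by (metis count_mset_0_iff greaterThan_iff subsetD)
  qed
qed

text \<open>Shows that the description defining \<open>atoms\<close> is proper: sorting gives
  existence, and equality of multisets gives uniqueness.\<close>

lemma atoms_dirac_sum: "atoms (dirac_sum xs) = sort (filter (\<lambda>x. x > 0) xs)"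
  unfolding atoms_def
proof (rule the_equality)
  show "sorted (sort (filter (\<lambda>x. x > 0) xs)) \<and> set (sort (filter (\<lambda>x. x > 0) xs)) \<subseteq> {0<..} \<and>
    dirac_sum xs = dirac_sum (sort (filter (\<lambda>x. x > 0) xs))"
    using dirac_sum_cong_mset[of "sort (filter (\<lambda>x. x > 0) xs)" "filter (\<lambda>x. x > 0) xs"]
    by (auto simp: dirac_sum_filter_pos)
next
  fix ys assume *: "sorted ys \<and> set ys \<subseteq> {0<..} \<and> dirac_sum xs = dirac_sum ys"
  then have "mset ys = mset (filter (\<lambda>x. x > 0) xs)"
    by (intro mset_eq_of_dirac_sum_eq) (auto simp: dirac_sum_filter_pos)
  then show "ys = sort (filter (\<lambda>x. x > 0) xs)"
    using * by (metis properties_for_sort)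
qed

lemma dirac_sum_atoms: "\<mu> \<in> counting_measures \<Longrightarrow> dirac_sum (atoms \<mu>) = \<mu>"
  using dirac_sum_cong_mset[of "sort (filter (\<lambda>x. x > 0) xs)" "filter (\<lambda>x. x > 0) xs" for xs]
  by (auto simp: counting_measures_eq_range atoms_dirac_sum dirac_sum_filter_pos)

lemma atoms_pos: "\<mu> \<in> counting_measures \<Longrightarrow> x \<in> set (atoms \<mu>) \<Longrightarrow> x > 0"
  by (auto simp: counting_measures_eq_range atoms_dirac_sum)

lemma sorted_atoms: "\<mu> \<in> counting_measures \<Longrightarrow> sorted (atoms \<mu>)"
  by (auto simp: counting_measures_eq_range atoms_dirac_sum)

lemma le_last_of_sorted: "sorted xs \<Longrightarrow> x \<in> set xs \<Longrightarrow> x \<le> last xs"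
  by (induction xs) auto

text \<open>The condition \<open>c \<ge> 0\<close> matches the default value 0 for the zero
  measure.\<close>

lemma largest_atom_le_iff:
  assumes "\<mu> \<in> counting_measures" "c \<ge> 0"
  shows "largest_atom \<mu> \<le> c \<longleftrightarrow> (\<forall>x\<in>set (atoms \<mu>). x \<le> c)"
proof (cases "atoms \<mu> = []")
  case False
  then show ?thesis
    using le_last_of_sorted[OF sorted_atoms[OF assms(1)]] last_in_set[OF False]
    by (auto simp: largest_atom_def intro: order_trans)
qed (use assms(2) in \<open>simp add: largest_atom_def\<close>)

text \<open>Entries that \<open>shift_down\<close> deletes become nonpositive after subtracting
  \<open>y\<close>, hence invisible. As \<open>y \<ge> 0\<close>, the same is true of entries that
  were nonpositive before.\<close>

lemma shift_down_dirac_sum: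
  assumes "y \<ge> 0"
  shows "shift_down y (dirac_sum xs) = dirac_sum (map (\<lambda>a. a - y) xs)"
proof -
  let ?S = "sort (filter (\<lambda>x. x > 0) xs)"
  have "shift_down y (dirac_sum xs) = dirac_sum (map (\<lambda>a. a - y) (filter (\<lambda>a. a > y) ?S))"
    by (simp add: shift_down_def atoms_dirac_sum)
  also have "\<dots> = dirac_sum (map (\<lambda>a. a - y) (filter (\<lambda>a. a > y) (filter (\<lambda>x. x > 0) xs)))"
    by (rule dirac_sum_cong_mset) (simp add: filter_sort)
  also have "\<dots> = dirac_sum (map (\<lambda>a. a - y) xs)"
    using assms by (intro dirac_sum_cong_pos) (auto simp: filter_map comp_def intro!: filter_cong arg_cong[where f="map _"])
  finally show ?thesis .
qed

lemma add_dirac_dirac_sum: "add_dirac (dirac_sum xs) x = dirac_sum (x # xs)"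
  unfolding add_dirac_def dirac_sum_def[of "x # xs"]
  by (intro measure_of_eq)
    (auto simp: sets.space_closed sets.sigma_sets_eq emeasure_dirac_sum add.commute)

lemma integral_dirac_sum:
  fixes f :: "real \<Rightarrow> real"
  assumes "f \<in> borel_measurable pos_borel" "set xs \<subseteq> {0<..}"
  shows "integral\<^sup>L (dirac_sum xs) f = (\<Sum>x\<leftarrow>xs. f x)"
proof -
  have "{i. i < length xs \<and> xs ! i > 0} = {0..<length xs}"
    using assms(2) nth_mem by fastforce
  then show ?thesis
    unfolding dirac_sum_eq_distr using assms nth_mem
    by (subst integral_distr)
      (fastforce simp: space_pos_borel lebesgue_integral_count_space_finite sum_list_sum_nth)+
qed

lemma borel_measurable_pos_borel:
  "continuous_on {0<..} f \<Longrightarrow> f \<in> borel_measurable pos_borel"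
  unfolding pos_borel_def by (rule borel_measurable_continuous_on_restrict)

section \<open>List forms of \<open>mu_PD\<close> and of the queue recursion\<close>

lemma mu_PD_eq_dirac_sum:
  assumes "\<And>j. j > n \<Longrightarrow> residual P \<theta> \<xi> \<sigma> j \<omega> \<le> 0"
  shows "mu_PD P \<theta> \<xi> \<sigma> \<omega> = dirac_sum (map (\<lambda>j. residual P \<theta> \<xi> \<sigma> j \<omega>) [1..<Suc n])"
proof -
  let ?r = "\<lambda>j. residual P \<theta> \<xi> \<sigma> j \<omega>"
  have "(\<Sum>i. if ?r (Suc i) > 0 then indicator B (?r (Suc i)) else 0) =
      (\<Sum>x\<leftarrow>filter (\<lambda>x. x > 0) (map ?r [1..<Suc n]). indicator B x :: ennreal)" for B
  proof -
    \<comment> \<open>Summand \<open>i\<close> belongs to residual \<open>Suc i\<close>, so all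
      summands from \<open>i = n\<close> on vanish.\<close>
    have "(\<Sum>i. if ?r (Suc i) > 0 then indicator B (?r (Suc i)) else 0 :: ennreal) =
        (\<Sum>i\<in>{0..<n}. if ?r (Suc i) > 0 then indicator B (?r (Suc i)) else 0)"
      by (intro suminf_finite) (simp_all add: not_less less_Suc_eq_le assms[THEN leD])
    also have "\<dots> = (\<Sum>x\<leftarrow>filter (\<lambda>x. x > 0) (map ?r [1..<Suc n]). indicator B x)"
      by (induction n) auto
    finally show ?thesis .
  qed
  then show ?thesis
    unfolding mu_PD_def by (subst dirac_sum_filter_pos[symmetric]) (simp add: dirac_sum_def)
qed

text \<open>Closed form of the recursion. The mass \<open>s k\<close> is added before the shift by
  \<open>x k\<close>, so its total shift starts with \<open>x k\<close> itself.\<close>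

lemma shift_add_iterate:
  assumes "m 0 = dirac_sum xs" "\<And>k. k < n \<Longrightarrow> x k \<ge> 0"
    and "\<And>k. k < n \<Longrightarrow> m (Suc k) = shift_down (x k) (add_dirac (m k) (s k))"
  shows "m n = dirac_sum (map (\<lambda>a. a - sum x {..<n}) xs @ map (\<lambda>k. s k - sum x {k..<n}) [0..<n])"
  using assms
proof (induction n)
  case (Suc n)
  let ?L = "map (\<lambda>a. a - sum x {..<n}) xs @ map (\<lambda>k. s k - sum x {k..<n}) [0..<n]"
  have "m (Suc n) = shift_down (x n) (add_dirac (dirac_sum ?L) (s n))"
    using Suc by simp
  also have "\<dots> = dirac_sum (map (\<lambda>a. a - x n) (s n # ?L))"
    using Suc.prems(2) by (simp only: add_dirac_dirac_sum shift_down_dirac_sum lessI)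
  also have "\<dots> = dirac_sum (map (\<lambda>a. a - x n) ?L @ [s n - x n])"
    by (rule dirac_sum_cong_mset) simp
  also have "map (\<lambda>a. a - x n) ?L @ [s n - x n] =
      map (\<lambda>a. a - sum x {..<Suc n}) xs @ map (\<lambda>k. s k - sum x {k..<Suc n}) [0..<Suc n]"
    by (auto simp: algebra_simps)
  finally show ?case .
qed simp

subsection \<open>Measurability for the weak topology\<close>

lemma openin_weak_topology_subset: "openin weak_topology W \<Longrightarrow> W \<subseteq> counting_measures"
proof -
  assume "openin weak_topology W"
  then have "W \<subseteq> topspace weak_topology" by (rule openin_subset)
  then show ?thesis by (auto simp: weak_topology_def)
qed

lemma space_counting_algebra: "space counting_algebra = counting_measures"
  unfolding counting_algebra_def using openin_weak_topology_subset by (intro space_measure_of) auto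

lemma open_in_counting_algebra: "openin weak_topology W \<Longrightarrow> W \<in> sets counting_algebra"
  unfolding counting_algebra_def using openin_weak_topology_subset by (intro in_measure_of) auto

lemma measurable_counting_algebraI:
  assumes "\<And>\<omega>. \<omega> \<in> space M \<Longrightarrow> f \<omega> \<in> counting_measures"
    and "\<And>W. openin weak_topology W \<Longrightarrow> f -` W \<inter> space M \<in> sets M"
  shows "f \<in> M \<rightarrow>\<^sub>M counting_algebra"
  unfolding counting_algebra_def
  using assms openin_weak_topology_subset by (intro measurable_measure_of) auto

text \<open>Induction over the generation of the topology. On a generator the integral is a finite
  sum of values of \<open>f\<close>, which depends continuously on the entries as long as these stay
  in the open half-line where \<open>f\<close> is continuous.\<close>

lemma open_dirac_sum_map_preimage:
  assumes "openin weak_topology W"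
  shows "open {x :: nat \<Rightarrow> real. (\<forall>j\<in>set js. x j > 0) \<and> dirac_sum (map x js) \<in> W}"
proof -
  have "generate_topology_on {{\<mu> \<in> counting_measures. integral\<^sup>L \<mu> f \<in> U} | f U.
      continuous_on {0<..} f \<and> bounded (f ` {0<..}) \<and> open (U :: real set)} W"
    using assms by (simp add: weak_topology_def openin_topology_generated_by_iff)
  then show ?thesis
  proof induction
    case Empty
    then show ?case by simp
  next
    case (Int A B)
    from open_Int[OF Int.IH] show ?case by (rule back_subst) auto
  next
    case (UN K)
    from UN.IH have "open (\<Union>k\<in>K. {x. (\<forall>j\<in>set js. x j > 0) \<and> dirac_sum (map x js) \<in> k})"
      by (intro open_UN) auto
    then show ?case by (rule back_subst) auto
  next
    case (Basis S)
    then obtain f and U :: "real set" where S: "S = {\<mu> \<in> counting_measures. integral\<^sup>L \<mu> f \<in> U}"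
      and f: "continuous_on {0<..} f" and U: "open U" by auto
    let ?D = "{x :: nat \<Rightarrow> real. \<forall>j\<in>set js. x j > 0}"
    have "open (\<Inter>j\<in>set js. {x :: nat \<Rightarrow> real. 0 < x j})"
      by (intro open_INT ballI open_Collect_less continuous_intros continuous_on_product_coordinates) auto
    then have D: "open ?D" by (rule back_subst) auto
    have "continuous_on ?D (\<lambda>x. \<Sum>i\<in>{0..<length js}. f (x (js ! i)))"
      by (intro continuous_on_sum continuous_on_compose2[OF f]
        continuous_on_subset[OF continuous_on_product_coordinates]) auto
    then have "open ((\<lambda>x. \<Sum>i\<in>{0..<length js}. f (x (js ! i))) -` U \<inter> ?D)"
      using D U continuous_on_open_vimage by blast
    moreover have "integral\<^sup>L (dirac_sum (map x js)) f = (\<Sum>i\<in>{0..<length js}. f (x (js ! i)))"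
      if "x \<in> ?D" for x
      using that f by (subst integral_dirac_sum) (auto intro: borel_measurable_pos_borel simp: sum_list_sum_nth)
    ultimately show ?case
      by (elim back_subst[where P="open"]) (auto simp: S counting_measures_eq_range)
  qed
qed

text \<open>The map \<open>x \<mapsto> dirac_sum (map x js)\<close> is discontinuous where an entry changes sign, hence the
  decomposition according to the sublist of positive entries.\<close>

lemma measurable_dirac_sum_map:
  fixes r :: "nat \<Rightarrow> 'a \<Rightarrow> real"
  assumes [measurable]: "\<And>j. r j \<in> borel_measurable M"
  shows "(\<lambda>\<omega>. dirac_sum (map (\<lambda>j. r j \<omega>) js)) \<in> M \<rightarrow>\<^sub>M counting_algebra"
proof (rule measurable_counting_algebraI)
  fix W assume W: "openin weak_topology W"
  define E where "E ks = {x :: nat \<Rightarrow> real. (\<forall>j\<in>set ks. x j > 0) \<and> dirac_sum (map x ks) \<in> W}" for ks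
  have r: "(\<lambda>\<omega> j. r j \<omega>) \<in> borel_measurable M"
    by (rule measurable_coordinatewise_then_product) simp
  have E: "(\<lambda>\<omega> j. r j \<omega>) -` E ks \<inter> space M \<in> sets M" for ks
    using open_dirac_sum_map_preimage[OF W] unfolding E_def by (intro measurable_sets[OF r]) auto
  have filter: "{\<omega> \<in> space M. filter (\<lambda>j. r j \<omega> > 0) js = ks} \<in> sets M" for ks
  proof (induction js arbitrary: ks)
    case (Cons j js)
    have "{\<omega> \<in> space M. filter (\<lambda>j. r j \<omega> > 0) (j # js) = ks} =
      ({\<omega> \<in> space M. r j \<omega> > 0} \<inter> (if ks \<noteq> [] \<and> hd ks = j
          then {\<omega> \<in> space M. filter (\<lambda>j. r j \<omega> > 0) js = tl ks} else {})) \<union>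
      ({\<omega> \<in> space M. \<not> r j \<omega> > 0} \<inter> {\<omega> \<in> space M. filter (\<lambda>j. r j \<omega> > 0) js = ks})"
      by (cases ks) auto
    moreover have "\<dots> \<in> sets M" using Cons.IH by (intro sets.Un sets.Int) auto
    ultimately show ?case by simp
  qed simp
  have split: "dirac_sum (map (\<lambda>j. r j \<omega>) js) =
      dirac_sum (map (\<lambda>j. r j \<omega>) (filter (\<lambda>j. r j \<omega> > 0) js))" for \<omega>
    by (rule dirac_sum_cong_pos) (simp add: filter_map comp_def)
  \<comment> \<open>The union runs over all lists \<open>ks\<close> of naturals, of which there are
    countably many.\<close>
  have "(\<lambda>\<omega>. dirac_sum (map (\<lambda>j. r j \<omega>) js)) -` W \<inter> space M =
      (\<Union>ks. {\<omega> \<in> space M. filter (\<lambda>j. r j \<omega> > 0) js = ks} \<inter> ((\<lambda>\<omega> j. r j \<omega>) -` E ks \<inter> space M))"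
    (is "?A = ?B")
  proof (rule set_eqI)
    fix \<omega> show "\<omega> \<in> ?A \<longleftrightarrow> \<omega> \<in> ?B" using split[of \<omega>] by (auto simp: E_def)
  qed
  also have "\<dots> \<in> sets M"
    using E filter by (intro sets.countable_UN) auto
  finally show "(\<lambda>\<omega>. dirac_sum (map (\<lambda>j. r j \<omega>) js)) -` W \<inter> space M \<in> sets M" .
qed (simp add: counting_measures_eq_range)

lemma measurable_largest_atom: "largest_atom \<in> borel_measurable counting_algebra"
proof (rule borel_measurable_iff_greater[THEN iffD2], rule allI)
  fix c :: real
  show "{\<mu> \<in> space counting_algebra. c < largest_atom \<mu>} \<in> sets counting_algebra"
  proof (cases "c \<ge> 0")
    case True
    \<comment> \<open>A bounded continuous ramp that is positive exactly beyond \<open>c\<close>: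
      its integral is positive iff some atom exceeds \<open>c\<close>.\<close>
    define f :: "real \<Rightarrow> real" where "f x = min 1 (max 0 (x - c))" for x
    have cont: "continuous_on {0<..} f" unfolding f_def by (intro continuous_intros)
    have "bounded (f ` {0<..})"
      by (rule boundedI[of _ 1]) (auto simp: f_def)
    then have "openin weak_topology {\<mu> \<in> counting_measures. integral\<^sup>L \<mu> f \<in> {0<..}}"
      unfolding weak_topology_def openin_topology_generated_by_iff using cont
      by (intro generate_topology_on.Basis CollectI exI[of _ f] exI[of _ "{0<..}"]) auto
    moreover have "c < largest_atom \<mu> \<longleftrightarrow> 0 < integral\<^sup>L \<mu> f" if \<mu>: "\<mu> \<in> counting_measures" for \<mu>
    proof -
      have "integral\<^sup>L \<mu> f = (\<Sum>x\<leftarrow>atoms \<mu>. f x)"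
        using integral_dirac_sum[OF borel_measurable_pos_borel[OF cont], of "atoms \<mu>"]
          atoms_pos[OF \<mu>] dirac_sum_atoms[OF \<mu>] by auto
      moreover have "0 < (\<Sum>x\<leftarrow>xs. f x) \<longleftrightarrow> \<not> (\<forall>x\<in>set xs. x \<le> c)" for xs
      proof -
        have "0 \<le> (\<Sum>x\<leftarrow>xs. f x)" for xs by (rule sum_list_nonneg) (auto simp: f_def)
        then show ?thesis
          by (induction xs) (auto simp: f_def add_nonneg_pos add_pos_nonneg max_def min_def)
      qed
      ultimately show ?thesis using largest_atom_le_iff[OF \<mu> True] by auto
    qed
    ultimately show ?thesis
      by (auto dest!: open_in_counting_algebra simp: space_counting_algebra cong: conj_cong)
  next
    case False
    have "0 \<le> largest_atom \<mu>" if "\<mu> \<in> counting_measures" for \<mu>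
      using atoms_pos[OF that, of "last (atoms \<mu>)"] last_in_set[of "atoms \<mu>"]
      by (auto simp: largest_atom_def)
    then have "{\<mu> \<in> space counting_algebra. c < largest_atom \<mu>} = space counting_algebra"
      using False by (fastforce simp: space_counting_algebra)
    then show ?thesis by simp
  qed
qed

subsection \<open>Growth of ergodic sums\<close>

text \<open>\<open>loynes_max T g n \<omega>\<close> is the maximum over \<open>k \<le> n\<close> of \<open>g (T \<omega>) + \<dots> + g (T\<^sup>k \<omega>)\<close>.\<close>

primrec loynes_max :: "('a \<Rightarrow> 'a) \<Rightarrow> ('a \<Rightarrow> real) \<Rightarrow> nat \<Rightarrow> 'a \<Rightarrow> real" where
  "loynes_max T g 0 \<omega> = 0"
| "loynes_max T g (Suc n) \<omega> = max 0 (g (T \<omega>) + loynes_max T g n (T \<omega>))"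

lemma loynes_max_nonneg: "loynes_max T g n \<omega> \<ge> 0"
  by (cases n) auto

lemma loynes_max_mono: "loynes_max T g n \<omega> \<le> loynes_max T g (Suc n) \<omega>"
proof (induction n arbitrary: \<omega>)
  case (Suc n)
  show ?case using Suc[of "T \<omega>"] by (subst (1 2) loynes_max.simps) (auto simp del: loynes_max.simps)
qed simp

text \<open>Dropping the truncation at 0 from the recursion leaves the ergodic sum. Bounded maxima
  thus give sums that are bounded above.\<close>

lemma sum_le_loynes_max: "(\<Sum>i = 1..n. g ((T ^^ i) \<omega>)) \<le> loynes_max T g n \<omega>"
proof (induction n arbitrary: \<omega>)
  case (Suc n)
  have "(\<Sum>i = 1..Suc n. g ((T ^^ i) \<omega>)) = g (T \<omega>) + (\<Sum>i = 1..n. g ((T ^^ i) (T \<omega>)))"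
    by (simp only: sum.atLeast_Suc_atMost[of 1 "Suc n"] sum.shift_bounds_cl_Suc_ivl)
      (simp add: funpow_swap1 sum.atLeast_Suc_atMost[of 1 "Suc n"] sum.shift_bounds_cl_Suc_ivl)
  then show ?case using Suc[of "T \<omega>"] by simp
qed simp

section \<open>The backward shift and its stationarity\<close>

context ergodic_shift
begin

text \<open>Backward shift: \<open>T ^^ n\<close> moves the origin to customer -n. It inverts
  \<open>\<theta>\<close> on \<open>space P\<close> only, hence the frequent membership
  hypotheses.\<close>

abbreviation T :: "'a \<Rightarrow> 'a" where "T \<equiv> inv_into (space P) \<theta>"

lemmas [measurable] = measurable_shift measurable_inv_shift

lemma measurable_T_pow [measurable]: "T ^^ n \<in> P \<rightarrow>\<^sub>M P"
  by (rule measurable_compose_n) (rule measurable_inv_shift)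

lemma T_pow_space: "\<omega> \<in> space P \<Longrightarrow> (T ^^ n) \<omega> \<in> space P"
  by (rule measurable_space[OF measurable_T_pow])

lemma shift_T: "\<omega> \<in> space P \<Longrightarrow> \<theta> (T \<omega>) = \<omega>"
  using bij_shift by (simp add: bij_betw_inv_into_right)

lemma T_shift: "\<omega> \<in> space P \<Longrightarrow> T (\<theta> \<omega>) = \<omega>"
  using bij_shift by (simp add: bij_betw_inv_into_left)

lemma shift_T_pow: "\<omega> \<in> space P \<Longrightarrow> k \<le> n \<Longrightarrow> (\<theta> ^^ k) ((T ^^ n) \<omega>) = (T ^^ (n - k)) \<omega>"
proof (induction k)
  case (Suc k)
  then have "(T ^^ (n - k)) \<omega> = T ((T ^^ (n - Suc k)) \<omega>)"
    by (metis Suc_diff_le Suc_le_lessD diff_Suc_Suc funpow.simps(2) o_apply Suc_diff_Suc)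
  then show ?case using Suc by (simp add: shift_T T_pow_space)
qed simp

lemma shift_pow_uminus: "shift_pow P \<theta> (- int n) = T ^^ n"
  by (auto simp: shift_pow_def)

lemma shift_pow_of_nat: "shift_pow P \<theta> (int n) = \<theta> ^^ n"
  by (simp add: shift_pow_def)

lemma distr_shift: "distr P P \<theta> = P"
  by (rule measure_eqI) (simp_all add: emeasure_distr measurable_shift emeasure_eq_measure stationary)

text \<open>Stationarity is assumed for \<open>\<theta>\<close>. Pushing
  \<open>P = distr P P \<theta>\<close> forward by \<open>T\<close> and cancelling
  \<open>T (\<theta> \<omega>) = \<omega>\<close> transfers it to \<open>T\<close>.\<close>

lemma distr_T_pow: "distr P P (T ^^ n) = P"
proof (induction n)
  case 0
  then show ?case by (simp add: id_def)
next
  case (Suc n)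
  have "distr P P T = distr (distr P P \<theta>) P T" by (simp add: distr_shift)
  also have "\<dots> = distr P P (T \<circ> \<theta>)" by (rule distr_distr) measurable
  also have "\<dots> = distr P P (\<lambda>\<omega>. \<omega>)" by (rule distr_cong) (simp_all add: T_shift)
  finally have "distr P P T = P" by simp
  moreover have "distr P P (T ^^ Suc n) = distr (distr P P (T ^^ n)) P T"
    unfolding funpow.simps by (rule distr_distr[symmetric]) measurable
  ultimately show ?case using Suc by (simp only:)
qed

text \<open>Every \<open>T ^^ n\<close> preserves \<open>P\<close>, and countably many null sets are
  discarded, so the property holds along the whole backward orbit.\<close>

lemma AE_T_pow: "AE \<omega> in P. Q \<omega> \<Longrightarrow> AE \<omega> in P. \<forall>n. Q ((T ^^ n) \<omega>)"
  unfolding AE_all_countable using AE_distrD[OF measurable_T_pow] distr_T_pow by metis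

lemma AE_shift: "AE \<omega> in P. Q \<omega> \<Longrightarrow> AE \<omega> in P. Q (\<theta> \<omega>)"
  using AE_distrD[OF measurable_shift] distr_shift by metis

lemma prob_T_pow:
  "{\<omega> \<in> space P. Q \<omega>} \<in> sets P \<Longrightarrow> prob {\<omega> \<in> space P. Q ((T ^^ n) \<omega>)} = prob {\<omega> \<in> space P. Q \<omega>}"
  using measure_distr[OF measurable_T_pow, of "{\<omega> \<in> space P. Q \<omega>}" n]
  by (simp add: distr_T_pow) (auto intro!: arg_cong[where f="measure P"] simp: T_pow_space)

lemma measurable_loynes_max [measurable]:
  "g \<in> borel_measurable P \<Longrightarrow> loynes_max T g n \<in> borel_measurable P"
proof (induction n)
  case (Suc n)
  then have [measurable]: "g \<in> borel_measurable P" "loynes_max T g n \<in> borel_measurable P" by auto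
  have "loynes_max T g (Suc n) = (\<lambda>\<omega>. max 0 (g (T \<omega>) + loynes_max T g n (T \<omega>)))" by auto
  then show ?case by simp
next
  case 0
  have "loynes_max T g 0 = (\<lambda>\<omega>. 0)" by auto
  then show ?case by simp
qed

lemma integral_T:
  fixes f :: "'a \<Rightarrow> real"
  assumes "f \<in> borel_measurable P"
  shows "(\<integral>\<omega>. f (T \<omega>) \<partial>P) = (\<integral>\<omega>. f \<omega> \<partial>P)"
  using integral_distr[OF measurable_inv_shift assms] distr_T_pow[of 1] by simp

lemma integrable_T:
  fixes f :: "'a \<Rightarrow> real"
  assumes "integrable P f"
  shows "integrable P (\<lambda>\<omega>. f (T \<omega>))"
  using integrable_distr[OF measurable_inv_shift, of f] distr_T_pow[of 1] assms by simp

lemma integrable_loynes_max: "integrable P g \<Longrightarrow> integrable P (loynes_max T g n)"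
proof (induction n)
  case (Suc n)
  then have "integrable P (\<lambda>\<omega>. max 0 (g (T \<omega>) + loynes_max T g n (T \<omega>)))"
    using integrable_T[of "loynes_max T g n"] integrable_T[of g] by auto
  then show ?case by (rule back_subst) auto
next
  case 0
  have "loynes_max T g 0 = (\<lambda>\<omega>. 0)" by auto
  then show ?case by simp
qed

text \<open>Garsia's argument: if the maxima \<open>M n\<close> of the partial sums were unbounded, then
  \<open>max 0 (g + M n) - M n = max (- M n) g\<close>, whose integral is nonnegative by stationarity, would
  converge to \<open>g\<close>.\<close>

lemma AE_bounded_partial_sums:
  fixes g :: "'a \<Rightarrow> real"
  assumes g: "integrable P g" and neg: "(\<integral>\<omega>. g \<omega> \<partial>P) < 0"
  shows "AE \<omega> in P. \<exists>C. \<forall>n. (\<Sum>i = 1..n. g ((T ^^ i) \<omega>)) \<le> C"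
proof -
  let ?M = "loynes_max T g"
  have [measurable]: "g \<in> borel_measurable P" using g by auto
  \<comment> \<open>The event that the maxima are unbounded; quantifying over naturals keeps it
    measurable.\<close>
  define A where "A = {\<omega> \<in> space P. \<forall>k::nat. \<exists>n. real k < ?M n \<omega>}"
  have A[measurable]: "A \<in> sets P" unfolding A_def by measurable
  have inv: "\<theta> \<omega> \<in> A \<longleftrightarrow> \<omega> \<in> A" if \<omega>: "\<omega> \<in> space P" for \<omega>
  proof -
    \<comment> \<open>Hence \<open>?M (Suc n) (\<theta> \<omega>)\<close> and
      \<open>?M n \<omega>\<close> differ by at most \<open>\<bar>g \<omega>\<bar>\<close>, which
      makes unboundedness invariant.\<close>
    have step: "?M (Suc n) (\<theta> \<omega>) = max 0 (g \<omega> + ?M n \<omega>)" for n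
      by (simp add: T_shift \<omega>)
    have "(\<forall>k::nat. \<exists>n. real k < ?M n (\<theta> \<omega>)) \<longleftrightarrow> (\<forall>k::nat. \<exists>n. real k < ?M n \<omega>)"
    proof safe
      fix k :: nat assume "\<forall>k::nat. \<exists>n. real k < ?M n (\<theta> \<omega>)"
      then obtain n where "real (k + nat \<lceil>\<bar>g \<omega>\<bar>\<rceil>) < ?M n (\<theta> \<omega>)" by blast
      then have "real k + \<bar>g \<omega>\<bar> < ?M (Suc n) (\<theta> \<omega>)"
        using loynes_max_mono[of T g n "\<theta> \<omega>"] by (simp del: loynes_max.simps) linarith
      then have "real k < ?M n \<omega>" unfolding step by (auto simp: max_def split: if_splits)
      then show "\<exists>n. real k < ?M n \<omega>" ..
    next
      fix k :: nat assume "\<forall>k::nat. \<exists>n. real k < ?M n \<omega>"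
      then obtain n where "real (k + nat \<lceil>\<bar>g \<omega>\<bar>\<rceil>) < ?M n \<omega>" by blast
      then have "real k + \<bar>g \<omega>\<bar> < ?M n \<omega>" by simp linarith
      then have "real k < ?M (Suc n) (\<theta> \<omega>)" unfolding step by (auto simp: max_def)
      then show "\<exists>n. real k < ?M n (\<theta> \<omega>)" ..
    qed
    then show ?thesis
      using \<omega> measurable_space[OF measurable_shift \<omega>] by (simp add: A_def)
  qed
  have "\<theta> ` A = A"
  proof safe
    fix \<omega> assume "\<omega> \<in> A" then show "\<theta> \<omega> \<in> A" using inv by (auto simp: A_def)
  next
    fix \<omega> assume \<omega>: "\<omega> \<in> A"
    then have "\<omega> \<in> space P" by (simp add: A_def)
    then have "\<omega> = \<theta> (T \<omega>)" "T \<omega> \<in> A"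
      using \<omega> inv[of "T \<omega>"] T_pow_space[of \<omega> 1] by (auto simp: shift_T)
    then show "\<omega> \<in> \<theta> ` A" by blast
  qed
  from ergodic[OF A this] have "prob A = 0"
  proof
    assume "prob A = 1"
    then have AE_A: "AE \<omega> in P. \<omega> \<in> A" using A by (simp add: prob_eq_1)
    have "0 \<le> (\<integral>\<omega>. max (- ?M n \<omega>) (g \<omega>) \<partial>P)" for n
    proof -
      \<comment> \<open>\<open>?M (Suc n)\<close> is the left integrand composed with
        \<open>T\<close>, so stationarity applies.\<close>
      have "(\<integral>\<omega>. max 0 (g \<omega> + ?M n \<omega>) \<partial>P) = (\<integral>\<omega>. ?M (Suc n) \<omega> \<partial>P)"
        by (subst integral_T[symmetric]) (auto intro!: Bochner_Integration.integral_cong)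
      also have "\<dots> \<ge> (\<integral>\<omega>. ?M n \<omega> \<partial>P)"
        by (intro integral_mono integrable_loynes_max g loynes_max_mono)
      finally have "0 \<le> (\<integral>\<omega>. max 0 (g \<omega> + ?M n \<omega>) - ?M n \<omega> \<partial>P)"
        by (subst Bochner_Integration.integral_diff)
          (auto intro!: integrable_max integrable_loynes_max g)
      also have "(\<lambda>\<omega>. max 0 (g \<omega> + ?M n \<omega>) - ?M n \<omega>) = (\<lambda>\<omega>. max (- ?M n \<omega>) (g \<omega>))"
        by (auto simp: max_def)
      finally show ?thesis .
    qed
    moreover have "(\<lambda>n. \<integral>\<omega>. max (- ?M n \<omega>) (g \<omega>) \<partial>P) \<longlonglongrightarrow> (\<integral>\<omega>. g \<omega> \<partial>P)"
    proof (rule integral_dominated_convergence[where w="\<lambda>\<omega>. \<bar>g \<omega>\<bar>"])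
      \<comment> \<open>On \<open>A\<close> the maxima eventually exceed
        \<open>- g \<omega>\<close>, and monotonicity in \<open>n\<close> keeps them there.\<close>
      show "AE \<omega> in P. (\<lambda>n. max (- ?M n \<omega>) (g \<omega>)) \<longlonglongrightarrow> g \<omega>"
        using AE_A
      proof eventually_elim
        case (elim \<omega>)
        obtain k :: nat where k: "- g \<omega> \<le> real k" using real_arch_simple by blast
        obtain N where N: "real k < ?M N \<omega>" using elim by (auto simp: A_def)
        have "?M N \<omega> \<le> ?M n \<omega>" if "n \<ge> N" for n
          using that loynes_max_mono by (rule lift_Suc_mono_le[rotated])
        then have "max (- ?M n \<omega>) (g \<omega>) = g \<omega>" if "n \<ge> N" for n
          using that k N by (fastforce simp: max_def)
        then show ?case by (intro tendsto_eventually eventually_sequentiallyI[of N])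
      qed
      \<comment> \<open>Since \<open>?M n\<close> is nonnegative, the maximum is either
        \<open>g \<omega>\<close> or lies between \<open>g \<omega>\<close> and 0.\<close>
      show "AE \<omega> in P. norm (max (- ?M n \<omega>) (g \<omega>)) \<le> \<bar>g \<omega>\<bar>" for n
      proof (rule AE_I2)
        fix \<omega>
        show "norm (max (- ?M n \<omega>) (g \<omega>)) \<le> \<bar>g \<omega>\<bar>"
          using loynes_max_nonneg[of T g n \<omega>] by (auto simp: max_def)
      qed
    qed (use g in auto)
    ultimately have "0 \<le> (\<integral>\<omega>. g \<omega> \<partial>P)" by (intro LIMSEQ_le_const) auto
    then show ?thesis using neg by simp
  qed
  then have "AE \<omega> in P. \<omega> \<notin> A" using A by (simp add: prob_eq_0)
  with AE_space show ?thesis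
  proof eventually_elim
    case (elim \<omega>)
    then obtain k :: nat where "\<forall>n. ?M n \<omega> \<le> real k" by (auto simp: A_def not_less)
    then show ?case using sum_le_loynes_max[of g T \<omega>] by (meson order_trans)
  qed
qed

text \<open>The partial sums of \<open>2 * \<epsilon> - \<xi>\<close> are bounded above once the
  mean of \<open>\<xi>\<close> exceeds \<open>2 * \<epsilon>\<close>.\<close>

lemma AE_linear_growth:
  assumes "integrable P \<xi>" "AE \<omega> in P. \<xi> \<omega> > 0"
  obtains \<epsilon> :: real where "\<epsilon> > 0"
    "AE \<omega> in P. \<exists>N. \<forall>n\<ge>N. \<epsilon> * real n \<le> (\<Sum>i = 1..n. \<xi> ((T ^^ i) \<omega>))"
proof -
  have nonneg: "AE \<omega> in P. 0 \<le> \<xi> \<omega>" using assms(2) by auto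
  have "(\<integral>\<omega>. \<xi> \<omega> \<partial>P) \<noteq> 0"
  proof
    assume "(\<integral>\<omega>. \<xi> \<omega> \<partial>P) = 0"
    then have "AE \<omega> in P. \<xi> \<omega> = 0"
      using integral_nonneg_eq_0_iff_AE[OF assms(1) nonneg] by simp
    with assms(2) have "AE \<omega> in P. False" by eventually_elim simp
    then show False by simp
  qed
  with integral_nonneg_AE[OF nonneg] have pos: "(\<integral>\<omega>. \<xi> \<omega> \<partial>P) > 0" by simp
  \<comment> \<open>A quarter of the mean makes the mean of \<open>2 * \<epsilon> - \<xi>\<close>
    negative; of the resulting slope \<open>2 * \<epsilon>\<close>, one half is spent on absorbing
    the constant \<open>C\<close>.\<close>
  define \<epsilon> where "\<epsilon> = (\<integral>\<omega>. \<xi> \<omega> \<partial>P) / 4"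
  have "(\<integral>\<omega>. 2 * \<epsilon> - \<xi> \<omega> \<partial>P) < 0"
    using pos assms(1) by (simp add: \<epsilon>_def prob_space)
  then have "AE \<omega> in P. \<exists>C. \<forall>n. (\<Sum>i = 1..n. 2 * \<epsilon> - \<xi> ((T ^^ i) \<omega>)) \<le> C"
    using assms(1) by (intro AE_bounded_partial_sums) auto
  then have "AE \<omega> in P. \<exists>N. \<forall>n\<ge>N. \<epsilon> * real n \<le> (\<Sum>i = 1..n. \<xi> ((T ^^ i) \<omega>))"
  proof eventually_elim
    case (elim \<omega>)
    then obtain C where C: "\<And>n. (\<Sum>i = 1..n. 2 * \<epsilon> - \<xi> ((T ^^ i) \<omega>)) \<le> C" by blast
    obtain N :: nat where N: "C \<le> real N * \<epsilon>" using ex_less_of_nat_mult[of \<epsilon> C] pos by (auto simp: \<epsilon>_def intro: less_imp_le)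
    show ?case
    proof (intro exI allI impI)
      fix n assume "n \<ge> N"
      then have "real N * \<epsilon> \<le> real n * \<epsilon>" using pos by (intro mult_right_mono) (auto simp: \<epsilon>_def)
      then show "\<epsilon> * real n \<le> (\<Sum>i = 1..n. \<xi> ((T ^^ i) \<omega>))"
        using C[of n] N by (simp add: sum_subtractf algebra_simps)
    qed
  qed
  then show thesis using pos by (intro that[of \<epsilon>]) (auto simp: \<epsilon>_def)
qed

text \<open>Borel-Cantelli: by stationarity the probabilities are those of
  \<open>\<epsilon> * n < \<sigma>\<close>, whose sum over positive \<open>n\<close> is at most the
  mean of \<open>\<bar>\<sigma>\<bar> / \<epsilon>\<close>.\<close>

lemma AE_eventually_le_linear:
  assumes \<sigma>: "integrable P \<sigma>" and \<epsilon>: "\<epsilon> > 0"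
  shows "AE \<omega> in P. \<exists>N. \<forall>n\<ge>N. \<sigma> ((T ^^ n) \<omega>) \<le> \<epsilon> * real n"
proof -
  have [measurable]: "\<sigma> \<in> borel_measurable P" using \<sigma> by auto
  let ?A = "\<lambda>n. {\<omega> \<in> space P. \<epsilon> * real (Suc n) < \<sigma> ((T ^^ Suc n) \<omega>)}"
  let ?B = "\<lambda>n. {\<omega> \<in> space P. \<epsilon> * real (Suc n) < \<sigma> \<omega>}"
  \<comment> \<open>The sum counts the integers \<open>Suc n\<close> with
    \<open>\<epsilon> * Suc n < \<sigma> \<omega>\<close>. Starting at 1 instead of 0 gives the
    bound without an additive constant.\<close>
  have "(\<Sum>n. indicator (?B n) \<omega> :: ennreal) \<le> ennreal (\<bar>\<sigma> \<omega>\<bar> / \<epsilon>)" for \<omega>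
  proof (rule suminf_le_const)
    fix m
    have "n < nat \<lfloor>\<bar>\<sigma> \<omega>\<bar> / \<epsilon>\<rfloor>" if "\<epsilon> * real (Suc n) < \<sigma> \<omega>" for n
    proof -
      have "real (Suc n) \<le> \<bar>\<sigma> \<omega>\<bar> / \<epsilon>" using that \<epsilon> by (simp add: field_simps)
      then have "int (Suc n) \<le> \<lfloor>\<bar>\<sigma> \<omega>\<bar> / \<epsilon>\<rfloor>" by (subst le_floor_iff) simp
      then show ?thesis by linarith
    qed
    then have "{n \<in> {..<m}. \<omega> \<in> ?B n} \<subseteq> {..<nat \<lfloor>\<bar>\<sigma> \<omega>\<bar> / \<epsilon>\<rfloor>}" by auto
    then have "card {n \<in> {..<m}. \<omega> \<in> ?B n} \<le> nat \<lfloor>\<bar>\<sigma> \<omega>\<bar> / \<epsilon>\<rfloor>"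
      using card_mono[of "{..<nat \<lfloor>\<bar>\<sigma> \<omega>\<bar> / \<epsilon>\<rfloor>}"] by simp
    then have card: "real (card {n \<in> {..<m}. \<omega> \<in> ?B n}) \<le> \<bar>\<sigma> \<omega>\<bar> / \<epsilon>"
      using \<epsilon> by (intro order_trans[OF of_nat_mono of_nat_floor]) auto
    have "(\<Sum>n<m. indicator (?B n) \<omega> :: ennreal) = of_nat (card {n \<in> {..<m}. \<omega> \<in> ?B n})"
      by (simp add: indicator_def sum.If_cases Int_def)
    also have "\<dots> \<le> ennreal (\<bar>\<sigma> \<omega>\<bar> / \<epsilon>)"
      using card by (subst ennreal_of_nat_eq_real_of_nat) (rule ennreal_leI)
    finally show "(\<Sum>n<m. indicator (?B n) \<omega> :: ennreal) \<le> ennreal (\<bar>\<sigma> \<omega>\<bar> / \<epsilon>)" .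
  qed simp
  then have "(\<integral>\<^sup>+\<omega>. (\<Sum>n. indicator (?B n) \<omega>) \<partial>P) \<le> (\<integral>\<^sup>+\<omega>. ennreal (\<bar>\<sigma> \<omega>\<bar> / \<epsilon>) \<partial>P)"
    by (intro nn_integral_mono)
  also have "\<dots> < \<infinity>"
    using \<sigma> \<epsilon> integrableD(2)[of P "\<lambda>\<omega>. \<bar>\<sigma> \<omega>\<bar> / \<epsilon>"] by (simp add: top.not_eq_extremum)
  finally have "(\<Sum>n. emeasure P (?B n)) < \<infinity>"
    by (subst (asm) nn_integral_suminf) auto
  then have "summable (\<lambda>n. prob (?B n))"
    by (intro summable_suminf_not_top) (auto simp: emeasure_eq_measure)
  moreover have "prob (?A n) = prob (?B n)" for n
    by (rule prob_T_pow) measurable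
  ultimately have "summable (\<lambda>n. prob (?A n))" by simp
  then have "AE \<omega> in P. eventually (\<lambda>n. \<omega> \<in> space P - ?A n) sequentially"
    by (intro borel_cantelli_AE1) (auto simp: emeasure_eq_measure simp del: funpow.simps)
  with AE_space show ?thesis
  proof eventually_elim
    case (elim \<omega>)
    then obtain N where N: "\<And>n. n \<ge> N \<Longrightarrow> \<not> \<epsilon> * real (Suc n) < \<sigma> ((T ^^ Suc n) \<omega>)"
      by (auto simp: eventually_sequentially)
    have "\<sigma> ((T ^^ n) \<omega>) \<le> \<epsilon> * real n" if "n \<ge> Suc N" for n
      using N[of "n - 1"] that by (cases n) (auto simp: not_less)
    then show ?case by blast
  qed
qed

subsection \<open>The stationary queue\<close>

text \<open>Time between the arrivals of customers -n and 0.\<close>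

abbreviation elapsed :: "('a \<Rightarrow> real) \<Rightarrow> nat \<Rightarrow> 'a \<Rightarrow> real" where
  "elapsed \<xi> n \<omega> \<equiv> \<Sum>i = 1..n. \<xi> ((T ^^ i) \<omega>)"

lemma residual_eq: "residual P \<theta> \<xi> \<sigma> j \<omega> = \<sigma> ((T ^^ j) \<omega>) - elapsed \<xi> j \<omega>"
  by (simp add: residual_def shift_pow_uminus)

lemma measurable_residual [measurable]:
  assumes [measurable]: "\<xi> \<in> borel_measurable P" "\<sigma> \<in> borel_measurable P"
  shows "residual P \<theta> \<xi> \<sigma> j \<in> borel_measurable P"
proof -
  have "residual P \<theta> \<xi> \<sigma> j = (\<lambda>\<omega>. \<sigma> ((T ^^ j) \<omega>) - elapsed \<xi> j \<omega>)"
    using residual_eq by auto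
  then show ?thesis by simp
qed

text \<open>Includes \<open>j = 0\<close>, where \<open>residual\<close> is the full service time
  \<open>\<sigma> \<omega>\<close> of the customer just arriving.\<close>

lemma residual_shift:
  assumes "\<omega> \<in> space P"
  shows "residual P \<theta> \<xi> \<sigma> (Suc j) (\<theta> \<omega>) = residual P \<theta> \<xi> \<sigma> j \<omega> - \<xi> \<omega>"
proof -
  have T: "(T ^^ Suc i) (\<theta> \<omega>) = (T ^^ i) \<omega>" for i
    using assms by (simp add: funpow_Suc_right T_shift del: funpow.simps)
  have "elapsed \<xi> (Suc j) (\<theta> \<omega>) = (\<Sum>i = 0..j. \<xi> ((T ^^ Suc i) (\<theta> \<omega>)))"
    using sum.shift_bounds_cl_Suc_ivl[of "\<lambda>i. \<xi> ((T ^^ i) (\<theta> \<omega>))" 0 j]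
    by (simp del: funpow.simps)
  also have "\<dots> = \<xi> \<omega> + elapsed \<xi> j \<omega>"
    by (simp add: T sum.atLeast_Suc_atMost[of 0] del: funpow.simps)
  finally show ?thesis by (simp add: residual_eq T del: funpow.simps)
qed

lemma elapsed_add: "elapsed \<xi> (n + j) \<omega> = elapsed \<xi> n \<omega> + elapsed \<xi> j ((T ^^ n) \<omega>)"
  by (induction j) (simp_all add: funpow_add[symmetric, unfolded comp_def] funpow_add add.commute)

text \<open>The same customer \<open>n + j\<close> places back, seen at the arrival of customer -n,
  still has the intervening time left to serve.\<close>

lemma residual_T_pow:
  "residual P \<theta> \<xi> \<sigma> j ((T ^^ n) \<omega>) = residual P \<theta> \<xi> \<sigma> (n + j) \<omega> + elapsed \<xi> n \<omega>"
  using elapsed_add[of \<xi> \<omega> n j] funpow_add[of j n T]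
  by (simp add: residual_eq add.commute)

text \<open>Each residual in the supremum is one beyond index \<open>n\<close>, hence nonpositive,
  plus the elapsed time. The comparison with 0 in \<open>max_residual\<close> uses that the elapsed
  time is nonnegative.\<close>

lemma max_residual_T_pow_le:
  assumes "\<And>i. 0 \<le> \<xi> ((T ^^ i) \<omega>)" "\<And>j. j > n \<Longrightarrow> residual P \<theta> \<xi> \<sigma> j \<omega> \<le> 0"
  shows "max_residual P \<theta> \<xi> \<sigma> ((T ^^ n) \<omega>) \<le> ereal (elapsed \<xi> n \<omega>)"
  using assms(1) assms(2)[of "n + _"] unfolding max_residual_def residual_T_pow
  by (auto intro!: SUP_least sum_nonneg simp: zero_ereal_def)

text \<open>The hypotheses say that \<open>m 0\<close>, \<dots>, \<open>m n\<close> are the states seen by the customers \<open>-n\<close>, \<dots>, \<open>0\<close>,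
  that the initial customers have left at time \<open>0\<close>, and that no customer before \<open>-n\<close> matters.\<close>

lemma backward_iterate_eq_mu_PD:
  assumes "\<omega> \<in> space P" "\<And>i. 0 \<le> \<xi> ((T ^^ i) \<omega>)" "m 0 \<in> counting_measures"
    and step: "\<And>k. k < n \<Longrightarrow> m (Suc k) =
      shift_down (\<xi> ((T ^^ (n - k)) \<omega>)) (add_dirac (m k) (\<sigma> ((T ^^ (n - k)) \<omega>)))"
    and old: "largest_atom (m 0) \<le> elapsed \<xi> n \<omega>"
    and late: "\<And>j. j > n \<Longrightarrow> residual P \<theta> \<xi> \<sigma> j \<omega> \<le> 0"
  shows "m n = mu_PD P \<theta> \<xi> \<sigma> \<omega>"
proof -
  let ?x = "\<lambda>k. \<xi> ((T ^^ (n - k)) \<omega>)" and ?s = "\<lambda>k. \<sigma> ((T ^^ (n - k)) \<omega>)"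
  have sum: "sum ?x {k..<n} = elapsed \<xi> (n - k) \<omega>" for k
    by (rule sum.reindex_bij_witness[where i="\<lambda>i. n - i" and j="\<lambda>i. n - i"]) auto
  have res: "?s k - sum ?x {k..<n} = residual P \<theta> \<xi> \<sigma> (n - k) \<omega>" for k
    unfolding sum residual_eq ..
  have "sum ?x {..<n} = elapsed \<xi> n \<omega>"
    using sum[of 0] by (simp add: atLeast0LessThan)
  \<comment> \<open>The total shift carries every initial atom out of the half-line, so the first
    block of the list contributes nothing.\<close>
  then have neg: "a - sum ?x {..<n} \<le> 0" if "a \<in> set (atoms (m 0))" for a
    using old that largest_atom_le_iff[OF assms(3), of "elapsed \<xi> n \<omega>"] assms(2)
    by (auto simp: sum_nonneg)
  have "m n = dirac_sum (map (\<lambda>a. a - sum ?x {..<n}) (atoms (m 0)) @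
      map (\<lambda>k. ?s k - sum ?x {k..<n}) [0..<n])"
    using assms(2,3) step by (intro shift_add_iterate) (auto simp: dirac_sum_atoms)
  also have "\<dots> = dirac_sum (map (\<lambda>k. residual P \<theta> \<xi> \<sigma> (n - k) \<omega>) [0..<n])"
    unfolding res using neg by (intro dirac_sum_cong_pos) (auto simp: filter_empty_conv not_less)
  \<comment> \<open>The recursion lists customers from the oldest on, \<open>mu_PD\<close> from the
    most recent back.\<close>
  also have "map (\<lambda>k. residual P \<theta> \<xi> \<sigma> (n - k) \<omega>) [0..<n] =
      rev (map (\<lambda>j. residual P \<theta> \<xi> \<sigma> j \<omega>) [1..<Suc n])"
    by (rule nth_equalityI) (simp_all add: rev_nth Suc_diff_Suc del: upt_Suc)
  also have "dirac_sum \<dots> = dirac_sum (map (\<lambda>j. residual P \<theta> \<xi> \<sigma> j \<omega>) [1..<Suc n])"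
    by (rule dirac_sum_cong_mset) (simp del: upt_Suc)
  also have "\<dots> = mu_PD P \<theta> \<xi> \<sigma> \<omega>"
    using late by (rule mu_PD_eq_dirac_sum[symmetric])
  finally show ?thesis .
qed

text \<open>From \<open>\<theta> \<omega>\<close> each customer is one place further back: the new
  list is that of \<open>\<omega>\<close> started at index 0 and lowered by
  \<open>\<xi> \<omega>\<close>.\<close>

lemma mu_PD_shift:
  assumes "\<omega> \<in> space P" "0 \<le> \<xi> \<omega>" "\<And>j. j > n \<Longrightarrow> residual P \<theta> \<xi> \<sigma> j \<omega> \<le> 0"
  shows "mu_PD P \<theta> \<xi> \<sigma> (\<theta> \<omega>) = shift_down (\<xi> \<omega>) (add_dirac (mu_PD P \<theta> \<xi> \<sigma> \<omega>) (\<sigma> \<omega>))"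
proof -
  let ?r = "\<lambda>j. residual P \<theta> \<xi> \<sigma> j \<omega>"
  have "residual P \<theta> \<xi> \<sigma> j (\<theta> \<omega>) \<le> 0" if "j > Suc n" for j
  proof -
    have "residual P \<theta> \<xi> \<sigma> (j - 1) \<omega> \<le> 0" using that by (intro assms(3)) auto
    then show ?thesis
      using that assms(2) residual_shift[OF assms(1), of \<xi> \<sigma> "j - 1"] by simp
  qed
  then have "mu_PD P \<theta> \<xi> \<sigma> (\<theta> \<omega>) =
      dirac_sum (map (\<lambda>j. residual P \<theta> \<xi> \<sigma> j (\<theta> \<omega>)) [1..<Suc (Suc n)])"
    by (rule mu_PD_eq_dirac_sum)
  also have "map (\<lambda>j. residual P \<theta> \<xi> \<sigma> j (\<theta> \<omega>)) [1..<Suc (Suc n)] =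
      map (\<lambda>a. a - \<xi> \<omega>) (map ?r [0..<Suc n])"
    using residual_shift[OF assms(1)] by (simp add: map_Suc_upt[symmetric] comp_def del: upt_Suc)
  also have "dirac_sum \<dots> = shift_down (\<xi> \<omega>) (dirac_sum (map ?r [0..<Suc n]))"
    using assms(2) by (rule shift_down_dirac_sum[symmetric])
  \<comment> \<open>The empty sum of interarrival times makes entry 0 equal to
    \<open>\<sigma> \<omega>\<close>, the mass added by the recursion.\<close>
  also have "map ?r [0..<Suc n] = \<sigma> \<omega> # map ?r [1..<Suc n]"
    by (simp add: upt_conv_Cons residual_eq del: upt_Suc)
  also have "dirac_sum \<dots> = add_dirac (mu_PD P \<theta> \<xi> \<sigma> \<omega>) (\<sigma> \<omega>)"
    using mu_PD_eq_dirac_sum[OF assms(3)] by (simp add: add_dirac_dirac_sum del: upt_Suc)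
  finally show ?thesis .
qed

text \<open>For a merely measurable \<open>Z\<close>, stationarity gives
  \<open>Z \<circ> T ^^ n\<close> the law of \<open>Z\<close>, so
  \<open>\<epsilon> * n < Z \<circ> T ^^ n\<close> has vanishing probability and cannot hold for all
  large \<open>n\<close> with positive probability.\<close>

lemma AE_frequently_le_linear:
  fixes Z :: "'a \<Rightarrow> real"
  assumes [measurable]: "Z \<in> borel_measurable P" and \<epsilon>: "\<epsilon> > 0"
  shows "AE \<omega> in P. \<forall>N. \<exists>n\<ge>N. Z ((T ^^ n) \<omega>) \<le> \<epsilon> * real n"
  unfolding AE_all_countable
proof
  fix N
  let ?B = "{\<omega> \<in> space P. \<forall>n\<ge>N. \<epsilon> * real n < Z ((T ^^ n) \<omega>)}"
  let ?C = "\<lambda>n. {\<omega> \<in> space P. \<epsilon> * real n < Z \<omega>}"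
  have "(\<lambda>n. prob (?C n)) \<longlonglongrightarrow> prob (\<Inter>n. ?C n)"
  proof (rule finite_Lim_measure_decseq)
    show "decseq ?C"
      unfolding decseq_def
    proof safe
      fix m n \<omega> assume "(m::nat) \<le> n" "\<epsilon> * real n < Z \<omega>"
      moreover from this have "\<epsilon> * real m \<le> \<epsilon> * real n" using \<epsilon> by simp
      ultimately show "\<epsilon> * real m < Z \<omega>" by linarith
    qed
  qed auto
  also have "(\<Inter>n. ?C n) = {}"
  proof -
    have "\<exists>n. \<not> \<epsilon> * real n < Z \<omega>" for \<omega>
      using ex_less_of_nat_mult[OF \<epsilon>, of "Z \<omega>"] by (auto simp: mult.commute intro: less_asym)
    then show ?thesis by blast
  qed
  finally have lim: "(\<lambda>n. prob (?C n)) \<longlonglongrightarrow> 0" by simp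
  have "prob ?B \<le> prob (?C n)" if "n \<ge> N" for n
  proof -
    have "prob ?B \<le> prob {\<omega> \<in> space P. \<epsilon> * real n < Z ((T ^^ n) \<omega>)}"
      using that by (intro finite_measure_mono) auto
    then show ?thesis using prob_T_pow[of "\<lambda>\<omega>. \<epsilon> * real n < Z \<omega>" n] by simp
  qed
  then have "prob ?B \<le> 0" using lim by (intro LIMSEQ_le_const) auto
  then have "AE \<omega> in P. \<omega> \<notin> ?B" by (subst prob_eq_0[symmetric]) (auto simp: measure_le_0_iff)
  with AE_space show "AE \<omega> in P. \<exists>n\<ge>N. Z ((T ^^ n) \<omega>) \<le> \<epsilon> * real n"
    by eventually_elim (auto simp: not_less)
qed

text \<open>The same slope \<open>\<epsilon>\<close> eventually bounds the service times from above
  and the elapsed times from below.\<close>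

lemma AE_residual_eventually_nonpos:
  assumes "integrable P \<xi>" "AE \<omega> in P. \<xi> \<omega> > 0" "integrable P \<sigma>"
  shows "AE \<omega> in P. \<exists>n. \<forall>j>n. residual P \<theta> \<xi> \<sigma> j \<omega> \<le> 0"
proof -
  obtain \<epsilon> :: real where "\<epsilon> > 0"
    and growth: "AE \<omega> in P. \<exists>N. \<forall>n\<ge>N. \<epsilon> * real n \<le> elapsed \<xi> n \<omega>"
    using AE_linear_growth[OF assms(1,2)] .
  from growth AE_eventually_le_linear[OF assms(3) \<open>\<epsilon> > 0\<close>] show ?thesis
  proof eventually_elim
    case (elim \<omega>)
    then obtain N N' where N: "\<And>n. n \<ge> N \<Longrightarrow> \<epsilon> * real n \<le> elapsed \<xi> n \<omega>"
      and N': "\<And>n. n \<ge> N' \<Longrightarrow> \<sigma> ((T ^^ n) \<omega>) \<le> \<epsilon> * real n" by blast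
    have "\<sigma> ((T ^^ j) \<omega>) \<le> elapsed \<xi> j \<omega>" if "j > max N N'" for j
      using that by (intro order_trans[OF N' N]) simp_all
    then show ?case by (intro exI[of _ "max N N'"]) (simp add: residual_eq)
  qed
qed

section \<open>Existence, uniqueness and coupling\<close>

lemma stationary_solution_exists:
  assumes "integrable P \<xi>" "AE \<omega> in P. \<xi> \<omega> > 0" "integrable P \<sigma>"
  shows "\<exists>\<mu>. stationary_solution P \<theta> \<xi> \<sigma> \<mu> \<and> (AE \<omega> in P. \<mu> \<omega> = mu_PD P \<theta> \<xi> \<sigma> \<omega>)"
proof -
  have [measurable]: "\<xi> \<in> borel_measurable P" "\<sigma> \<in> borel_measurable P" using assms by auto
  let ?r = "residual P \<theta> \<xi> \<sigma>"
  define E where "E n = {\<omega> \<in> space P. \<forall>j>n. ?r j \<omega> \<le> 0}" for n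
  \<comment> \<open>A solution must take values in \<open>counting_measures\<close> everywhere, so
    \<open>mu_PD\<close> is replaced by the zero measure where infinitely many residuals are
    positive.\<close>
  define \<mu> where "\<mu> \<omega> = (if \<exists>n. \<omega> \<in> E n then mu_PD P \<theta> \<xi> \<sigma> \<omega> else dirac_sum [])" for \<omega>
  have E[measurable]: "E n \<in> sets P" for n unfolding E_def by measurable
  have on_E: "mu_PD P \<theta> \<xi> \<sigma> \<omega> = dirac_sum (map (\<lambda>j. ?r j \<omega>) [1..<Suc n])" if "\<omega> \<in> E n" for n \<omega>
    using that by (intro mu_PD_eq_dirac_sum) (auto simp: E_def)
  have "\<mu> \<in> P \<rightarrow>\<^sub>M counting_algebra"
  proof (rule measurable_counting_algebraI)
    fix W assume W: "openin weak_topology W"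
    have pre: "(\<lambda>\<omega>. dirac_sum (map (\<lambda>j. ?r j \<omega>) js)) -` W \<inter> space P \<in> sets P" for js
      using measurable_dirac_sum_map[of ?r P js] open_in_counting_algebra[OF W]
      by (intro measurable_sets) auto
    \<comment> \<open>On each \<open>E n\<close> the map is a Dirac sum of fixed length, whose
      measurability is known; the empty list handles the exceptional set.\<close>
    have "\<mu> -` W \<inter> space P =
        (\<Union>n. E n \<inter> ((\<lambda>\<omega>. dirac_sum (map (\<lambda>j. ?r j \<omega>) [1..<Suc n])) -` W \<inter> space P)) \<union>
        ((space P - (\<Union>n. E n)) \<inter> ((\<lambda>\<omega>. dirac_sum (map (\<lambda>j. ?r j \<omega>) [])) -` W \<inter> space P))"
      (is "_ = ?R")
    proof (rule set_eqI)
      fix \<omega>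
      show "\<omega> \<in> \<mu> -` W \<inter> space P \<longleftrightarrow> \<omega> \<in> ?R"
        by (cases "\<exists>n. \<omega> \<in> E n") (auto simp: \<mu>_def on_E[symmetric] simp del: upt_Suc One_nat_def)
    qed
    also have "\<dots> \<in> sets P"
      by (intro sets.Un sets.countable_UN image_subsetI sets.Int sets.Diff pre E sets.top)
    finally show "\<mu> -` W \<inter> space P \<in> sets P" .
  qed (use on_E in \<open>auto simp: \<mu>_def counting_measures_eq_range\<close>)
  moreover have eq: "AE \<omega> in P. \<mu> \<omega> = mu_PD P \<theta> \<xi> \<sigma> \<omega>"
    using AE_space AE_residual_eventually_nonpos[OF assms]
    by eventually_elim (auto simp: \<mu>_def E_def)
  moreover have "AE \<omega> in P. \<mu> (\<theta> \<omega>) = shift_down (\<xi> \<omega>) (add_dirac (\<mu> \<omega>) (\<sigma> \<omega>))"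
    using AE_space AE_residual_eventually_nonpos[OF assms] assms(2) eq AE_shift[OF eq]
  proof eventually_elim
    case (elim \<omega>)
    then obtain n where "\<forall>j>n. ?r j \<omega> \<le> 0" by blast
    then show ?case using elim mu_PD_shift[of \<omega> \<xi> n \<sigma>] by simp
  qed
  ultimately show ?thesis unfolding stationary_solution_def by blast
qed

text \<open>By stationarity \<open>largest_atom (\<mu> \<circ> T ^^ n)\<close> is tight, hence almost surely infinitely often
  below \<open>\<epsilon> n\<close> and so below the time elapsed since the arrival of customer \<open>-n\<close>.\<close>

lemma stationary_solution_unique:
  assumes "integrable P \<xi>" "AE \<omega> in P. \<xi> \<omega> > 0" "integrable P \<sigma>"
    and sol: "stationary_solution P \<theta> \<xi> \<sigma> \<mu>"
  shows "AE \<omega> in P. \<mu> \<omega> = mu_PD P \<theta> \<xi> \<sigma> \<omega>"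
proof -
  obtain \<epsilon> :: real where "\<epsilon> > 0"
    and growth: "AE \<omega> in P. \<exists>N. \<forall>n\<ge>N. \<epsilon> * real n \<le> elapsed \<xi> n \<omega>"
    using AE_linear_growth[OF assms(1,2)] .
  have \<mu>: "\<mu> \<in> P \<rightarrow>\<^sub>M counting_algebra"
    and eq: "AE \<omega> in P. \<mu> (\<theta> \<omega>) = shift_down (\<xi> \<omega>) (add_dirac (\<mu> \<omega>) (\<sigma> \<omega>))"
    using sol by (auto simp: stationary_solution_def)
  have Z: "(\<lambda>\<omega>. largest_atom (\<mu> \<omega>)) \<in> borel_measurable P"
    by (rule measurable_compose[OF \<mu> measurable_largest_atom])
  from AE_space growth AE_frequently_le_linear[OF Z \<open>\<epsilon> > 0\<close>] AE_T_pow[OF assms(2)] AE_T_pow[OF eq]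
    AE_residual_eventually_nonpos[OF assms(1-3)]
  show ?thesis
  proof eventually_elim
    case (elim \<omega>)
    from elim(2) obtain N where N: "\<And>n. n \<ge> N \<Longrightarrow> \<epsilon> * real n \<le> elapsed \<xi> n \<omega>" by blast
    from elim(6) obtain N' where N': "\<And>j. j > N' \<Longrightarrow> residual P \<theta> \<xi> \<sigma> j \<omega> \<le> 0" by blast
    \<comment> \<open>A single \<open>n\<close> past both thresholds suffices, since the value
      \<open>\<mu> \<omega>\<close> reached at time 0 does not depend on the starting point.\<close>
    from elim(3) obtain n where n: "n \<ge> max N N'" "largest_atom (\<mu> ((T ^^ n) \<omega>)) \<le> \<epsilon> * real n"
      by blast
    \<comment> \<open>The stationary states along the orbit from customer -n to customer 0.\<close>
    let ?m = "\<lambda>k. \<mu> ((T ^^ (n - k)) \<omega>)"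
    have "?m n = mu_PD P \<theta> \<xi> \<sigma> \<omega>"
    proof (rule backward_iterate_eq_mu_PD[where m="?m"])
      show "?m 0 \<in> counting_measures"
        using measurable_space[OF \<mu> T_pow_space[OF elim(1)]] by (simp add: space_counting_algebra)
      show "?m (Suc k) = shift_down (\<xi> ((T ^^ (n - k)) \<omega>)) (add_dirac (?m k) (\<sigma> ((T ^^ (n - k)) \<omega>)))"
        if "k < n" for k
      proof -
        have "\<theta> ((T ^^ (n - k)) \<omega>) = (T ^^ (n - Suc k)) \<omega>"
          using that shift_T_pow[OF elim(1), of 1 "n - k"] by simp
        then show ?thesis using elim(5)[rule_format, of "n - k"] by simp
      qed
      show "largest_atom (?m 0) \<le> elapsed \<xi> n \<omega>"
        using n N[of n] by simp
    qed (use elim(1,4) n(1) N' in \<open>auto intro: less_imp_le\<close>)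
    then show ?case by simp
  qed
qed

text \<open>The last index with a positive residual serves as coupling time: from then on every
  start customer -n is early enough, and \<open>max_residual_T_pow_le\<close> shows that the initial
  customers are gone by time 0.\<close>

lemma queue_seq_coupling:
  assumes "integrable P \<xi>" "AE \<omega> in P. \<xi> \<omega> > 0" "integrable P \<sigma>"
    and \<zeta>: "\<zeta> \<in> P \<rightarrow>\<^sub>M counting_algebra"
    and le: "AE \<omega> in P. ereal (largest_atom (\<zeta> \<omega>)) \<le> max_residual P \<theta> \<xi> \<sigma> \<omega>"
  shows "strong_backwards_coupling P \<theta> (queue_seq P \<theta> \<xi> \<sigma> \<zeta>) (mu_PD P \<theta> \<xi> \<sigma>)"
  unfolding strong_backwards_coupling_def shift_pow_uminus
  using AE_space AE_T_pow[OF assms(2)] AE_T_pow[OF le] AE_residual_eventually_nonpos[OF assms(1-3)]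
proof eventually_elim
  case (elim \<omega>)
  from elim(4) obtain N where N: "\<And>j. j > N \<Longrightarrow> residual P \<theta> \<xi> \<sigma> j \<omega> \<le> 0" by blast
  have nonneg: "0 \<le> \<xi> ((T ^^ i) \<omega>)" for i using elim(2) by (auto intro: less_imp_le)
  have "queue_seq P \<theta> \<xi> \<sigma> \<zeta> n ((T ^^ n) \<omega>) = mu_PD P \<theta> \<xi> \<sigma> \<omega>"
    if n: "n \<ge> N" for n
  proof (rule backward_iterate_eq_mu_PD[where m="\<lambda>k. queue_seq P \<theta> \<xi> \<sigma> \<zeta> k ((T ^^ n) \<omega>)"])
    let ?m = "\<lambda>k. queue_seq P \<theta> \<xi> \<sigma> \<zeta> k ((T ^^ n) \<omega>)"
    show "?m 0 \<in> counting_measures"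
      using measurable_space[OF \<zeta> T_pow_space[OF elim(1)]] by (simp add: space_counting_algebra)
    \<comment> \<open>Step \<open>k\<close> of the queue started at customer -n serves customer
      \<open>-(n - k)\<close>, because \<open>\<theta> ^^ k\<close> undoes \<open>k\<close> of the
      \<open>n\<close> backward shifts.\<close>
    show "?m (Suc k) = shift_down (\<xi> ((T ^^ (n - k)) \<omega>)) (add_dirac (?m k) (\<sigma> ((T ^^ (n - k)) \<omega>)))"
      if "k < n" for k
      using that elim(1) by (simp add: shift_pow_of_nat shift_T_pow)
    have "ereal (largest_atom (?m 0)) \<le> ereal (elapsed \<xi> n \<omega>)"
      using order_trans[OF elim(3)[rule_format, of n] max_residual_T_pow_le[of \<xi> \<omega> n \<sigma>, OF nonneg]] n N
      by simp
    then show "largest_atom (?m 0) \<le> elapsed \<xi> n \<omega>" by simp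
  qed (use elim(1) nonneg N n in auto)
  then show ?case by blast
qed

end

theorem theorem1:
  fixes P :: "'a measure" and \<theta> :: "'a \<Rightarrow> 'a" and \<xi> \<sigma> :: "'a \<Rightarrow> real"
  assumes "ergodic_shift P \<theta>"
    and "integrable P \<xi>" and "AE \<omega> in P. \<xi> \<omega> > 0"
    and "integrable P \<sigma>" and "AE \<omega> in P. \<sigma> \<omega> > 0"
  shows "(AE \<omega> in P. mu_PD P \<theta> \<xi> \<sigma> \<omega> \<in> counting_measures) \<and>
    (\<exists>\<mu>. stationary_solution P \<theta> \<xi> \<sigma> \<mu> \<and> (AE \<omega> in P. \<mu> \<omega> = mu_PD P \<theta> \<xi> \<sigma> \<omega>)) \<and>
    (measure P {\<omega> \<in> space P. max_residual P \<theta> \<xi> \<sigma> \<omega> \<le> 0} > 0 \<longrightarrow>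
      (\<forall>\<mu>. stationary_solution P \<theta> \<xi> \<sigma> \<mu> \<longrightarrow> (AE \<omega> in P. \<mu> \<omega> = mu_PD P \<theta> \<xi> \<sigma> \<omega>)) \<and>
      (\<forall>\<zeta>. \<zeta> \<in> P \<rightarrow>\<^sub>M counting_algebra \<longrightarrow>
        (AE \<omega> in P. ereal (largest_atom (\<zeta> \<omega>)) \<le> max_residual P \<theta> \<xi> \<sigma> \<omega>) \<longrightarrow>
        strong_backwards_coupling P \<theta> (queue_seq P \<theta> \<xi> \<sigma> \<zeta>) (mu_PD P \<theta> \<xi> \<sigma>)))"
proof -
  interpret ergodic_shift P \<theta> by (rule assms(1))
  have "AE \<omega> in P. mu_PD P \<theta> \<xi> \<sigma> \<omega> \<in> counting_measures"
    using AE_residual_eventually_nonpos[OF assms(2-4)]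
  proof eventually_elim
    case (elim \<omega>)
    then obtain n where "\<forall>j>n. residual P \<theta> \<xi> \<sigma> j \<omega> \<le> 0" by blast
    then show ?case
      using mu_PD_eq_dirac_sum[of n P \<theta> \<xi> \<sigma> \<omega>] by (auto simp: counting_measures_eq_range)
  qed
  then show ?thesis
    using stationary_solution_exists[OF assms(2-4)] stationary_solution_unique[OF assms(2-4)]
      queue_seq_coupling[OF assms(2-4)] by blast
qed

end
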